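(* Let $n \ge 1$ and let $\theta_n = \sum_{r=1}^{2^{n-1}} \phi_{r,n}$. Then the $2$-cocycle $\theta_n$ encodes the thresholds in $A_n$ in the following sense: for every $p$ with $1 \le p < 2^{n-1}$, the value $\vartheta_n(p)+1$ is the smallest integer $y \in A_n$ satisfying $\theta_n(p,y) = 1$.
   Context: For $n \ge 0$, the $n$th Laver table is the set $A_n = \{1,\dots,2^n\}$ equipped with the unique binary operation $\triangleright_n$ such that, for all $x,y$, $x \triangleright_n 1 = (x+1) \bmod 2^n$ and $x \triangleright_n (y \triangleright_n 1) = (x \triangleright_n y) \triangleright_n (x \triangleright_n 1)$, where $a \bmod m$ denotes the unique integer in $\{1,\dots,m\}$ congruent to $a$ modulo $m$. (By a known theorem of Laver this operation exists, is unique, and satisfies the left-selfdistributivity law $x \triangleright (y \triangleright z) = (x \triangleright y) \triangleright (x \triangleright z)$.) Period: it is known (Laver) that for every $p \in A_n$ there is a unique power of two $2^r$ such that $p \triangleright_n 1 < p \triangleright_n 2 < \cdots < p \triangleright_n 2^r = 2^n$, and the subsequent values $p \triangleright_n q$ repeat periodically with period $2^r$; this number is denoted $\pi_n(p)$. Threshold: it is known (Laver) that for $n \ge 1$ and $1 \le p \le 2^{n-1}$ there is a number $r$ with $0 \le r \le \pi_{n-1}(p)$ such that $p \triangleright_n q = p \triangleright_{n-1} q$ for $1 \le q \le r$ and $p \triangleright_n q = p \triangleright_{n-1} q + 2^{n-1}$ for $r < q \le \pi_{n-1}(p)$; this (unique) number $r$ is denoted $\vartheta_n(p)$. For $q \in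 A_n$ define $\phi_{q,n}: A_n^2 \to \mathbb{Z}$ by $\phi_{q,n}(x,y) = \delta_{y,q} - \delta_{x \triangleright_n y,\,q}$, where $\delta$ is the Kronecker symbol. (These are rack $2$-cocycles, i.e. maps $\phi$ satisfying $\phi(x \triangleright y, x \triangleright z) + \phi(x,z) = \phi(x, y\triangleright z) + \phi(y,z)$.) *)

theory Defs
  imports "HOL-Library.FuncSet" "HOL-Number_Theory.Cong"
begin

definition laver_set :: "nat \<Rightarrow> nat set" where
  "laver_set n = {1..2 ^ n}"

(* Residues are taken in {1..m}, not in {0..<m} as for the library's mod. *)
definition pmod :: "nat \<Rightarrow> nat \<Rightarrow> nat" where
  "pmod a m = (THE r. r \<in> {1..m} \<and> [r = a] (mod m))"

definition is_laver_op :: "nat \<Rightarrow> (nat \<Rightarrow> nat \<Rightarrow> nat) \<Rightarrow> bool" where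
  "is_laver_op n f \<longleftrightarrow>
     (\<forall>x\<in>laver_set n. \<forall>y\<in>laver_set n. f x y \<in> laver_set n) \<and>
     (\<forall>x\<in>laver_set n. f x 1 = pmod (x + 1) (2 ^ n)) \<and>
     (\<forall>x\<in>laver_set n. \<forall>y\<in>laver_set n. f x (f y 1) = f (f x y) (f x 1))"

(* The operation is unique on laver_set n only; requiring it to be extensional
   makes it unique as a HOL function. *)
definition laver :: "nat \<Rightarrow> nat \<Rightarrow> nat \<Rightarrow> nat" where
  "laver n = (THE f. f \<in> laver_set n \<rightarrow>\<^sub>E (laver_set n \<rightarrow>\<^sub>E laver_set n) \<and> is_laver_op n f)"

definition is_laver_period :: "nat \<Rightarrow> nat \<Rightarrow> nat \<Rightarrow> bool" where
  "is_laver_period n p m \<longleftrightarrow>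
     (\<exists>r. m = 2 ^ r) \<and> m \<in> laver_set n \<and>
     strict_mono_on {1..m} (laver n p) \<and> laver n p m = 2 ^ n \<and>
     (\<forall>q. q \<in> laver_set n \<and> q + m \<in> laver_set n \<longrightarrow> laver n p (q + m) = laver n p q)"

definition laver_period :: "nat \<Rightarrow> nat \<Rightarrow> nat" where
  "laver_period n p = (THE m. is_laver_period n p m)"

(* Meaningful for n \<ge> 1 and 1 \<le> p \<le> 2 ^ (n - 1). *)
definition is_laver_threshold :: "nat \<Rightarrow> nat \<Rightarrow> nat \<Rightarrow> bool" where
  "is_laver_threshold n p r \<longleftrightarrow>
     r \<le> laver_period (n - 1) p \<and>
     (\<forall>q. 1 \<le> q \<and> q \<le> r \<longrightarrow> laver n p q = laver (n - 1) p q) \<and>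
     (\<forall>q. r < q \<and> q \<le> laver_period (n - 1) p \<longrightarrow>
        laver n p q = laver (n - 1) p q + 2 ^ (n - 1))"

definition laver_threshold :: "nat \<Rightarrow> nat \<Rightarrow> nat" where
  "laver_threshold n p = (THE r. is_laver_threshold n p r)"

definition rack_2cocycle_on ::
  "'a set \<Rightarrow> ('a \<Rightarrow> 'a \<Rightarrow> 'a) \<Rightarrow> ('a \<Rightarrow> 'a \<Rightarrow> int) \<Rightarrow> bool" where
  "rack_2cocycle_on A f \<phi> \<longleftrightarrow>
     (\<forall>x\<in>A. \<forall>y\<in>A. \<forall>z\<in>A. \<phi> (f x y) (f x z) + \<phi> x z = \<phi> x (f y z) + \<phi> y z)"

definition laver_phi :: "nat \<Rightarrow> nat \<Rightarrow> nat \<Rightarrow> nat \<Rightarrow> int" where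
  "laver_phi q n x y = of_bool (y = q) - of_bool (laver n x y = q)"

definition laver_theta :: "nat \<Rightarrow> nat \<Rightarrow> nat \<Rightarrow> int" where
  "laver_theta n x y = (\<Sum>r = 1..2 ^ (n - 1). laver_phi r n x y)"

end

theory Submission
  imports Defs
begin

text \<open>
  On \<open>{1..N}\<close> the two defining equations determine the operation by descending recursion on the
  left and ascending recursion on the right argument, since \<open>a \<triangleright> b > a\<close> for \<open>a < N\<close>. Each row
  increases until it reaches \<open>N\<close> and then repeats. If all rows for \<open>N\<close> have periods dividing
  \<open>N\<close>, then reduction modulo \<open>N\<close> is a homomorphism from the operation for \<open>2 * N\<close>, so a row of
  period \<open>p\<close> lifts to one of period \<open>p\<close> or \<open>2 * p\<close>; hence for \<open>N = 2 ^ n\<close> all periods are powers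
  of two, the recursion yields the Laver table, and the thresholds exist. Left selfdistributivity
  makes every map \<open>(x, y) \<mapsto> g y - g (x \<triangleright> y)\<close> a cocycle, and \<open>\<theta>\<^sub>n\<close> is the one for the indicator
  \<open>g\<close> of \<open>{1..2 ^ (n - 1)}\<close>. For the threshold claim, the only delicate case is that the threshold
  equals the period \<open>\<pi>\<close> of \<open>p\<close> in the smaller table; then \<open>p \<triangleright> \<pi> = 2 ^ (n - 1)\<close>, the next value
  is larger, and \<open>\<pi> < 2 ^ (n - 1)\<close> because the row of \<open>p\<close> starts at \<open>p + 1 > 1\<close>.
\<close>

section \<open>The recursively defined operation\<close>

text \<open>The right argument may be any natural number: setting \<open>a \<triangleright> 0 = N\<close> makes the recursion
  uniform, because \<open>N \<triangleright> (a + 1) = a + 1\<close>. The final \<open>0\<close> is never reached; the guard only serves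
  termination.\<close>

function laver_rec :: "nat \<Rightarrow> nat \<Rightarrow> nat \<Rightarrow> nat" where
  "laver_rec N a b =
     (if N \<le> a then b
      else if b = 0 then N
      else let c = laver_rec N a (b - 1) in if a < c then laver_rec N c (Suc a) else 0)"
  by pat_completeness auto
termination
  by (relation "measures [\<lambda>(N, a, b). N - a, \<lambda>(N, a, b). b]") auto

declare laver_rec.simps [simp del]

lemma laver_rec_top [simp]: "laver_rec N N b = b"
  by (simp add: laver_rec.simps)

lemma laver_rec_0: "a < N \<Longrightarrow> laver_rec N a 0 = N"
  by (simp add: laver_rec.simps)

text \<open>By induction \<open>c\<close> exceeds \<open>a\<close>, so the guard succeeds. For
  \<open>c < N\<close> the value lies in row \<open>c\<close> and hence above \<open>c\<close>; for
  \<open>c = N\<close> it is \<open>Suc a\<close>.\<close>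

lemma laver_rec_bounds:
  "a < N \<Longrightarrow> a < laver_rec N a b \<and> laver_rec N a b \<le> N"
proof (induction N a b rule: laver_rec.induct)
  case (1 N a b)
  show ?case
  proof (cases "b = 0")
    case True
    then show ?thesis using 1 by (simp add: laver_rec_0)
  next
    case False
    define c where "c = laver_rec N a (b - 1)"
    have c: "a < c" "c \<le> N"
      using 1 False by (auto simp: c_def)
    have "laver_rec N a b = laver_rec N c (Suc a)"
      using c(1) False 1(3) by (subst laver_rec.simps) (simp add: c_def Let_def)
    moreover have "c < laver_rec N c (Suc a) \<and> laver_rec N c (Suc a) \<le> N" if "c < N"
      using 1(2)[of c] that c False 1(3) by (simp add: c_def)
    ultimately show ?thesis
      using c 1(3) by (cases "c = N") auto
  qed
qed

lemma laver_rec_gt: "a < N \<Longrightarrow> a < laver_rec N a b"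
  and laver_rec_le: "a < N \<Longrightarrow> laver_rec N a b \<le> N"
  using laver_rec_bounds by auto

lemma laver_rec_Suc:
  assumes "a < N"
  shows "laver_rec N a (Suc b) = laver_rec N (laver_rec N a b) (Suc a)"
  using assms laver_rec_gt[OF assms, of b] by (subst laver_rec.simps) (simp add: Let_def)

lemma laver_rec_1: "a < N \<Longrightarrow> laver_rec N a 1 = Suc a"
  by (simp add: laver_rec_Suc laver_rec_0)

lemma laver_rec_less_Suc:
  "a < N \<Longrightarrow> laver_rec N a b < N \<Longrightarrow> laver_rec N a b < laver_rec N a (Suc b)"
  by (simp add: laver_rec_Suc[of a] laver_rec_gt)

text \<open>Row \<open>0\<close> imitates row \<open>N\<close>, so reducing a left argument
  \<open>N\<close> to \<open>0\<close> is harmless for right arguments in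
  \<open>{1..N}\<close>.\<close>

lemma laver_rec_zero_left: "1 \<le> b \<Longrightarrow> b \<le> N \<Longrightarrow> laver_rec N 0 b = b"
proof (induction b rule: nat_induct_at_least)
  case base
  then show ?case by (simp add: laver_rec_1[of 0, simplified])
next
  case (Suc b)
  then show ?case using laver_rec_1[of b N] by (simp add: laver_rec_Suc[of 0])
qed

section \<open>Periods\<close>

definition row_period :: "nat \<Rightarrow> nat \<Rightarrow> nat \<Rightarrow> bool" where
  "row_period N a m \<longleftrightarrow> 0 < m \<and> laver_rec N a m = N \<and> (\<forall>q. 0 < q \<and> q < m \<longrightarrow> laver_rec N a q < N)"

lemma laver_rec_less_row:
  assumes "a < N" and "\<And>q. x \<le> q \<Longrightarrow> q < y \<Longrightarrow> laver_rec N a q < N" and "x < y"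
  shows "laver_rec N a x < laver_rec N a y"
  using assms(3,2)
proof (induction y)
  case (Suc y)
  have "laver_rec N a y < laver_rec N a (Suc y)"
    using Suc.prems laver_rec_less_Suc[OF assms(1)] by simp
  then show ?case
    using Suc by (cases "x = y") (auto intro: less_trans)
qed simp

text \<open>Each entry of a row determines the next, and the value \<open>N\<close> at
  \<open>m\<close> is also the value at \<open>0\<close>, so the row restarts there.\<close>

lemma row_period_add:
  assumes "a < N" "row_period N a m"
  shows "laver_rec N a (q + m) = laver_rec N a q"
proof (induction q)
  case 0
  then show ?case using assms by (simp add: row_period_def laver_rec_0)
next
  case (Suc q)
  then show ?case using assms by (simp add: laver_rec_Suc)
qed

lemma row_period_mult:
  assumes "a < N" "row_period N a m"
  shows "laver_rec N a (q + k * m) = laver_rec N a q"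
proof (induction k)
  case (Suc k)
  have "laver_rec N a (q + k * m + m) = laver_rec N a (q + k * m)"
    by (rule row_period_add[OF assms])
  with Suc show ?case by (simp add: ac_simps)
qed simp

text \<open>The row climbs strictly from \<open>a + 1\<close> at \<open>1\<close> to
  \<open>N\<close> at \<open>m\<close>, which leaves room for at most \<open>N - a\<close>
  entries.\<close>

lemma row_period_le:
  assumes "a < N" "row_period N a m"
  shows "a + m \<le> N"
proof -
  have "a + q \<le> laver_rec N a q" if "1 \<le> q" "q \<le> m" for q
    using that
  proof (induction q rule: nat_induct_at_least)
    case base
    then show ?case using assms by (simp add: laver_rec_1[simplified])
  next
    case (Suc q)
    then have "laver_rec N a q < laver_rec N a (Suc q)"
      using assms by (intro laver_rec_less_Suc) (auto simp: row_period_def)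
    with Suc show ?case by simp
  qed
  from this[of m] show ?thesis using assms by (simp add: row_period_def)
qed

section \<open>Reduction modulo N and the doubling of periods\<close>

definition dyadic_periods :: "nat \<Rightarrow> bool" where
  "dyadic_periods N \<longleftrightarrow> (\<forall>a<N. \<exists>k. 2 ^ k dvd N \<and> row_period N a (2 ^ k))"

text \<open>The period of the row divides \<open>N\<close>, so shifts by multiples of
  \<open>N\<close> change nothing; residue \<open>0\<close> fits in because of the value
  \<open>N\<close> at \<open>0\<close>.\<close>

lemma laver_rec_mod_right:
  assumes "dyadic_periods N" "a < N"
  shows "laver_rec N a (b mod N) = laver_rec N a b"
proof -
  obtain k where k: "2 ^ k dvd N" "row_period N a (2 ^ k)"
    using assms by (auto simp: dyadic_periods_def)
  then obtain j where "N = j * 2 ^ k" by (metis dvd_div_mult_self)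
  then have "laver_rec N a (b mod N + (b div N) * j * 2 ^ k) = laver_rec N a (b mod N)"
    by (intro row_period_mult assms k)
  moreover have "b mod N + (b div N) * j * 2 ^ k = b"
    using \<open>N = j * 2 ^ k\<close> by (metis mod_div_mult_eq mult.assoc)
  ultimately show ?thesis by simp
qed

lemma laver_rec_right_top:
  assumes "dyadic_periods N" "a < N"
  shows "laver_rec N a N = N"
  using laver_rec_mod_right[OF assms, of N] assms by (simp add: laver_rec_0)

lemma laver_rec_zero_left_mod:
  assumes "dyadic_periods N" "0 < N"
  shows "laver_rec N 0 b mod N = b mod N"
proof (cases "b mod N = 0")
  case True
  then show ?thesis using laver_rec_mod_right[OF assms, of b] assms by (simp add: laver_rec_0)
next
  case False
  then show ?thesis
    using laver_rec_mod_right[OF assms, of b, symmetric] assms laver_rec_zero_left[of "b mod N" N]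
    by (simp add: Suc_le_eq)
qed

text \<open>The left argument is reduced into \<open>{0..<N}\<close>; row \<open>0\<close> agrees with row \<open>N\<close> modulo \<open>N\<close>.\<close>

lemma laver_rec_double_mod:
  assumes "dyadic_periods N" "0 < N" "a \<le> 2 * N"
  shows "laver_rec (2 * N) a b mod N = laver_rec N (a mod N) b mod N"
  using assms(3)
proof (induction "2 * N - a" arbitrary: a b rule: less_induct)
  case less
  note IH_left = less.hyps
  show ?case
  proof (cases "a = 2 * N")
    case True
    then show ?thesis using laver_rec_zero_left_mod[OF assms(1,2)] by simp
  next
    case False
    then have a: "a < 2 * N" using less.prems by simp
    define a' where "a' = a mod N"
    have a': "a' < N" using assms by (simp add: a'_def)
    show ?thesis
    proof (induction b)
      case 0
      then show ?case using a a' by (simp add: laver_rec_0 a'_def)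
    next
      case (Suc b)
      define c where "c = laver_rec (2 * N) a b"
      define d where "d = laver_rec N a' b"
      have c: "a < c" "c \<le> 2 * N" using laver_rec_bounds[OF a] by (auto simp: c_def)
      have d: "0 < d" "d \<le> N" using laver_rec_bounds[OF a', of b] by (auto simp: d_def)
      have cd: "c mod N = d mod N" using Suc by (simp add: c_def d_def a'_def)
      have "laver_rec (2 * N) a (Suc b) mod N = laver_rec (2 * N) c (Suc a) mod N"
        using a by (simp add: laver_rec_Suc c_def)
      also have "\<dots> = laver_rec N (c mod N) (Suc a) mod N"
        using c a by (intro IH_left) auto
      also have "laver_rec N (c mod N) (Suc a) = laver_rec N (c mod N) (Suc a')"
        using laver_rec_mod_right[OF assms(1), of "c mod N" "Suc a"]
          laver_rec_mod_right[OF assms(1), of "c mod N" "Suc a'"] assms(2)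
        by (simp add: a'_def mod_Suc_eq)
      \<comment> \<open>If \<open>d = N\<close>, then \<open>c mod N = 0\<close>, and rows
        \<open>0\<close> and \<open>N\<close> agree at \<open>Suc a'\<close>, which lies in
        \<open>{1..N}\<close>.\<close>
      also have "\<dots> = laver_rec N d (Suc a')"
        using d a' cd by (cases "d = N") (auto simp: laver_rec_zero_left)
      also have "\<dots> = laver_rec N a' (Suc b)"
        using a' by (simp add: laver_rec_Suc d_def)
      finally show ?case by (simp add: a'_def)
    qed
  qed
qed

text \<open>Both values agree modulo \<open>N\<close>; the ranges \<open>{1..2 * N}\<close> and
  \<open>{1..N}\<close> leave only these two possibilities.\<close>

lemma laver_rec_double_cases:
  assumes "dyadic_periods N" "a < N"
  shows "laver_rec (2 * N) a q = laver_rec N a q \<or> laver_rec (2 * N) a q = laver_rec N a q + N"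
proof -
  define v w where "v = laver_rec (2 * N) a q" and "w = laver_rec N a q"
  have v: "0 < v" "v \<le> 2 * N" using laver_rec_bounds[of a "2 * N" q] assms by (auto simp: v_def)
  have w: "0 < w" "w \<le> N" using laver_rec_bounds[of a N q] assms by (auto simp: w_def)
  have e: "v mod N = w mod N"
    using laver_rec_double_mod[OF assms(1), of a q] assms by (simp add: v_def w_def)
  have "v = w \<or> v = w + N"
  proof (cases "v \<le> N")
    case True
    with v w e show ?thesis
      by (cases "v = N"; cases "w = N") auto
  next
    case False
    define u where "u = v - N"
    have u: "v = u + N" "0 < u" "u \<le> N" using v False by (auto simp: u_def)
    then have "u mod N = w mod N" using e by simp
    with u w show ?thesis
      by (cases "u = N"; cases "w = N") auto
  qed
  then show ?thesis by (simp add: v_def w_def)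
qed

lemma row_period_mod_pos:
  assumes "a < N" "row_period N a m" "0 < q" "q < m"
  shows "0 < laver_rec N a q mod N"
  using assms laver_rec_gt[of a N q] by (simp add: row_period_def)

text \<open>Strictly between multiples of \<open>p\<close> the residue modulo \<open>N\<close> is
  nonzero, so row \<open>a\<close> cannot reach \<open>2 * N\<close> there. At \<open>p\<close> and
  \<open>2 * p\<close> its value is \<open>N\<close> or \<open>2 * N\<close>; if it is
  \<open>N\<close> at \<open>p\<close>, strict growth forces \<open>2 * N\<close> at
  \<open>2 * p\<close>.\<close>

lemma dyadic_periods_double:
  assumes "dyadic_periods N" "0 < N"
  shows "dyadic_periods (2 * N)"
  unfolding dyadic_periods_def
proof (intro allI impI)
  fix a assume a: "a < 2 * N"
  define a' where "a' = a mod N"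
  have a': "a' < N" using assms by (simp add: a'_def)
  obtain k where k: "2 ^ k dvd N" "row_period N a' (2 ^ k)"
    using assms a' by (auto simp: dyadic_periods_def)
  define p :: nat where "p = 2 ^ k"
  have p: "0 < p" "row_period N a' p" using k by (simp_all add: p_def)
  define v where "v = laver_rec (2 * N) a"
  have v_mod: "v q mod N = laver_rec N a' q mod N" for q
    using laver_rec_double_mod[OF assms, of a q] a by (simp add: v_def a'_def)
  have v_le: "v q \<le> 2 * N" "a < v q" for q using laver_rec_bounds[OF a] by (auto simp: v_def)
  have v_less: "v q < 2 * N" if "0 < q" "q < p" for q
    using row_period_mod_pos[OF a' p(2) that] v_mod[of q] v_le[of q] by (cases "v q = 2 * N") auto
  have N_dvd: "v q = N \<or> v q = 2 * N" if "laver_rec N a' q = N" for q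
  proof -
    have "N dvd v q" using v_mod[of q] that by (simp add: dvd_eq_mod_eq_0)
    then obtain j where j: "v q = N * j" ..
    then have "0 < j" "j \<le> 2" using v_le[of q] assms(2) by (auto intro!: Nat.gr0I)
    then have "j = 1 \<or> j = 2" by auto
    then show ?thesis using j by auto
  qed
  have vp: "v p = N \<or> v p = 2 * N"
    using N_dvd[of p] p by (simp add: row_period_def)
  show "\<exists>k. 2 ^ k dvd 2 * N \<and> row_period (2 * N) a (2 ^ k)"
  proof (cases "v p = 2 * N")
    case True
    then have "row_period (2 * N) a p"
      using p v_less by (auto simp: row_period_def v_def)
    then show ?thesis using k(1) p_def by (intro exI[of _ k]) auto
  next
    case False
    then have vpN: "v p = N" using vp by simp
    have shift: "laver_rec N a' (q + p) = laver_rec N a' q" for q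
      by (rule row_period_add[OF a' p(2)])
    have less: "v q < 2 * N" if "p \<le> q" "q < 2 * p" for q
    proof (cases "q = p")
      case True
      then show ?thesis using vpN assms(2) by simp
    next
      case False
      then have "0 < q - p" "q - p < p" using that by auto
      from row_period_mod_pos[OF a' p(2) this] have "0 < v q mod N"
        using v_mod[of q] shift[of "q - p"] that by simp
      then show ?thesis using v_le[of q] by (cases "v q = 2 * N") auto
    qed
    have "v p < v (2 * p)"
      using laver_rec_less_row[OF a, of p "2 * p"] less p(1) by (simp add: v_def)
    moreover have "v (2 * p) = N \<or> v (2 * p) = 2 * N"
      using N_dvd[of "2 * p"] shift[of p] p by (simp add: row_period_def mult_2)
    ultimately have "v (2 * p) = 2 * N" using vpN by auto
    moreover have "v q < 2 * N" if "0 < q" "q < 2 * p" for q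
      using less[of q] v_less[of q] that by (cases "q < p") auto
    ultimately have "row_period (2 * N) a (2 * p)"
      using p by (auto simp: row_period_def v_def)
    then show ?thesis using k(1) p_def by (intro exI[of _ "Suc k"]) auto
  qed
qed

lemma dyadic_periods_power: "dyadic_periods (2 ^ n)"
proof (induction n)
  case 0
  show ?case
    by (auto simp: dyadic_periods_def row_period_def laver_rec_1[simplified] intro!: exI[of _ 0])
next
  case (Suc n)
  then show ?case using dyadic_periods_double[of "2 ^ n"] by simp
qed

section \<open>Left selfdistributivity\<close>

lemma laver_rec_in:
  assumes "x \<in> {1..N}" "y \<in> {1..N}"
  shows "laver_rec N x y \<in> {1..N}"
proof (cases "x = N")
  case False
  then show ?thesis using assms laver_rec_bounds[of x N y] by auto
qed (use assms in auto)

lemma laver_rec_selfdistrib_1: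
  assumes "dyadic_periods N" "x \<in> {1..N}" "y \<in> {1..N}"
  shows "laver_rec N x (laver_rec N y 1) = laver_rec N (laver_rec N x y) (laver_rec N x 1)"
proof (cases "x = N")
  case False
  then have x: "x < N" using assms by simp
  show ?thesis
  proof (cases "y = N")
    case True
    then show ?thesis using laver_rec_right_top[OF assms(1) x] by simp
  next
    case False
    then have "y < N" using assms by simp
    then show ?thesis using x laver_rec_1[OF x] laver_rec_1[of y N] by (simp add: laver_rec_Suc)
  qed
qed simp

text \<open>Induction descends on \<open>x\<close>, then on \<open>y\<close>, and ascends on
  \<open>z\<close>. After expanding y \<triangleright> (z + 1) as (y \<triangleright> z)
  \<triangleright> (y \<triangleright> 1), the hypothesis for y \<triangleright> z > y distributes
  \<open>x\<close>, and the one for x \<triangleright> y > x factors the result back.\<close>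

lemma laver_rec_selfdistrib:
  assumes "dyadic_periods N" "x \<in> {1..N}" "y \<in> {1..N}" "z \<in> {1..N}"
  shows "laver_rec N x (laver_rec N y z) = laver_rec N (laver_rec N x y) (laver_rec N x z)"
  using assms(2-4)
proof (induction "N - x" arbitrary: x y z rule: less_induct)
  case less
  note IHx = less.hyps
  show ?case
  proof (cases "x = N")
    case False
    then have x: "x < N" "x \<in> {1..N}" using less.prems by auto
    show ?thesis
      using less.prems(2,3)
    proof (induction "N - y" arbitrary: y z rule: less_induct)
      case less
      note IHy = less.hyps
      show ?case
      proof (cases "y = N")
        case True
        then show ?thesis using laver_rec_right_top[OF assms(1) x(1)] by simp
      next
        case False
        then have y: "y < N" "y \<in> {1..N}" using less.prems by auto
        have "1 \<le> z" "z \<le> N" using less.prems by auto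
        then show ?thesis
        proof (induction z rule: nat_induct_at_least)
          case base
          then show ?case using laver_rec_selfdistrib_1[OF assms(1) x(2) y(2)] by simp
        next
          case (Suc z)
          let ?L = "laver_rec N"
          have z: "z < N" "z \<in> {1..N}" using Suc by auto
          have one: "1 \<in> {1..N}" using x by auto
          have step: "?L u (Suc z) = ?L (?L u z) (?L u 1)" if "u \<in> {1..N}" for u
            using laver_rec_selfdistrib_1[OF assms(1) that z(2)] laver_rec_1[OF z(1)] by simp
          have "?L x (?L y (Suc z)) = ?L x (?L (?L y z) (?L y 1))"
            using step[OF y(2)] by simp
          also have "\<dots> = ?L (?L x (?L y z)) (?L x (?L y 1))"
            using laver_rec_gt[OF y(1), of z] laver_rec_in[OF y(2) z(2)] laver_rec_in[OF y(2) one] y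
            by (intro IHy) auto
          also have "\<dots> = ?L (?L (?L x y) (?L x z)) (?L (?L x y) (?L x 1))"
            using Suc.IH z laver_rec_selfdistrib_1[OF assms(1) x(2) y(2)] by simp
          also have "\<dots> = ?L (?L x y) (?L (?L x z) (?L x 1))"
            using laver_rec_gt[OF x(1), of y] laver_rec_in[OF x(2) y(2)] laver_rec_in[OF x(2) z(2)]
              laver_rec_in[OF x(2) one] x
            by (intro IHx[symmetric]) auto
          also have "\<dots> = ?L (?L x y) (?L x (Suc z))"
            using step[OF x(2)] by simp
          finally show ?case .
        qed
      qed
    qed
  qed simp
qed

section \<open>Identification with the Laver table\<close>

lemma pmod_Suc:
  assumes "x \<in> {1..m}"
  shows "pmod (x + 1) m = laver_rec m x 1"
proof -
  have "laver_rec m x 1 = (if x = m then 1 else Suc x)"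
    using assms laver_rec_1[of x m] by auto
  moreover have "pmod (x + 1) m = (if x = m then 1 else Suc x)"
    unfolding pmod_def
  proof (rule the_equality)
    show "(if x = m then 1 else Suc x) \<in> {1..m} \<and> [if x = m then 1 else Suc x = x + 1] (mod m)"
      using assms by (auto simp: cong_def mod_Suc)
  next
    fix r assume r: "r \<in> {1..m} \<and> [r = x + 1] (mod m)"
    show "r = (if x = m then 1 else Suc x)"
    proof (cases "x = m")
      case True
      then have "r mod m = 1 mod m" using r by (auto simp: cong_def mod_Suc)
      then show ?thesis using r True by (cases "r = m"; cases "m = 1") auto
    next
      case False
      then have "r mod m = Suc x mod m" "Suc x \<le> m" using r assms by (auto simp: cong_def)
      then show ?thesis using r False by (cases "r = m"; cases "Suc x = m") auto
    qed
  qed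
  ultimately show ?thesis by simp
qed

text \<open>This is uniqueness: the axioms give \<open>f\<close> the same recursion, first in row
  \<open>N\<close>, then in the rows below it.\<close>

lemma laver_op_eq_laver_rec:
  assumes "is_laver_op n f" "x \<in> laver_set n" "y \<in> laver_set n"
  shows "f x y = laver_rec (2 ^ n) x y"
proof -
  define N :: nat where "N = 2 ^ n"
  have N: "laver_set n = {1..N}" "N \<in> {1..N}" by (auto simp: laver_set_def N_def)
  have f1: "f u 1 = laver_rec N u 1" if "u \<in> {1..N}" for u
  proof -
    have "f u 1 = pmod (u + 1) N"
      using assms(1) that unfolding is_laver_op_def N N_def[symmetric] by blast
    then show ?thesis using pmod_Suc[OF that] by simp
  qed
  have fS: "f u (Suc v) = f (f u v) (f u 1)" if "u \<in> {1..N}" "v \<in> {1..N}" "v < N" for u v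
  proof -
    have "f u (f v 1) = f (f u v) (f u 1)"
      using assms(1) that(1,2) unfolding is_laver_op_def N by blast
    then show ?thesis using f1[OF that(2)] laver_rec_1[OF that(3)] by simp
  qed
  have top: "f N v = v" if "1 \<le> v" "v \<le> N" for v
    using that
  proof (induction v rule: nat_induct_at_least)
    case base
    then show ?case using f1[OF N(2)] by simp
  next
    case (Suc v)
    then have v: "v \<in> {1..N}" "v < N" by auto
    then show ?case using fS[OF N(2) v] Suc f1[OF N(2)] f1[OF v(1)] laver_rec_1[OF v(2)] by simp
  qed
  have "f x y = laver_rec N x y"
    using assms(2,3) unfolding N
  proof (induction "N - x" arbitrary: x y rule: less_induct)
    case less
    show ?case
    proof (cases "x = N")
      case True
      then show ?thesis using top less.prems by simp
    next
      case False
      then have x: "x < N" "x \<in> {1..N}" using less.prems by auto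
      have "1 \<le> y" "y \<le> N" using less.prems by auto
      then show ?thesis
      proof (induction y rule: nat_induct_at_least)
        case base
        then show ?case using f1[OF x(2)] by simp
      next
        case (Suc y)
        then have y: "y \<in> {1..N}" "y < N" by auto
        have "f x (Suc y) = f (laver_rec N x y) (Suc x)"
          using fS[OF x(2) y] Suc f1[OF x(2)] laver_rec_1[OF x(1)] by simp
        also have "\<dots> = laver_rec N (laver_rec N x y) (Suc x)"
          using laver_rec_gt[OF x(1), of y] laver_rec_in[OF x(2) y(1)] x
          by (intro less.hyps) auto
        finally show ?case using x by (simp add: laver_rec_Suc)
      qed
    qed
  qed
  then show ?thesis by (simp add: N_def)
qed

text \<open>Restricted to the table, the recursive operation satisfies the axioms; uniqueness on the
  table and extensionality off it make it the one described by \<open>laver\<close>.\<close>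

lemma laver_eq_laver_rec:
  assumes "x \<in> laver_set n" "y \<in> laver_set n"
  shows "laver n x y = laver_rec (2 ^ n) x y"
proof -
  define g where "g = (\<lambda>x\<in>laver_set n. \<lambda>y\<in>laver_set n. laver_rec (2 ^ n) x y)"
  have g: "g u v = laver_rec (2 ^ n) u v" if "u \<in> laver_set n" "v \<in> laver_set n" for u v
    using that by (simp add: g_def)
  have closed: "laver_rec (2 ^ n) u v \<in> laver_set n" if "u \<in> laver_set n" "v \<in> laver_set n" for u v
    using that laver_rec_in[of u "2 ^ n" v] by (simp add: laver_set_def)
  have one: "1 \<in> laver_set n" by (simp add: laver_set_def)
  have g_op: "is_laver_op n g"
    unfolding is_laver_op_def
  proof (intro conjI ballI)
    fix u v assume uv: "u \<in> laver_set n" "v \<in> laver_set n"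
    show "g u v \<in> laver_set n" using closed[OF uv] g[OF uv] by simp
    show "g u (g v 1) = g (g u v) (g u 1)"
      using laver_rec_selfdistrib_1[OF dyadic_periods_power, of u n v] uv closed one
      by (simp add: g laver_set_def[symmetric] del: One_nat_def)
  next
    fix u assume "u \<in> laver_set n"
    then show "g u 1 = pmod (u + 1) (2 ^ n)"
      using pmod_Suc[of u "2 ^ n"] one g by (simp add: laver_set_def)
  qed
  have "laver n = g"
    unfolding laver_def
  proof (rule the_equality)
    show "g \<in> laver_set n \<rightarrow>\<^sub>E (laver_set n \<rightarrow>\<^sub>E laver_set n) \<and> is_laver_op n g"
      using g_op closed by (auto simp: g_def)
  next
    fix f assume f: "f \<in> laver_set n \<rightarrow>\<^sub>E (laver_set n \<rightarrow>\<^sub>E laver_set n) \<and> is_laver_op n f"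
    show "f = g"
    proof (rule ext)+
      fix u v
      show "f u v = g u v"
      proof (cases "u \<in> laver_set n")
        case True
        then have "f u \<in> laver_set n \<rightarrow>\<^sub>E laver_set n" using f by auto
        then show ?thesis
          using True conjunct2[OF f] laver_op_eq_laver_rec[of n f u v]
            PiE_arb[of "f u" "laver_set n" _ v]
          by (cases "v \<in> laver_set n") (auto simp: g_def)
      next
        case False
        then have "f u = undefined" using f by (blast intro: PiE_arb)
        then show ?thesis using False by (simp add: g_def)
      qed
    qed
  qed
  then show ?thesis using g[OF assms] by simp
qed

lemma laver_in_laver_set:
  assumes "x \<in> laver_set n" "y \<in> laver_set n"
  shows "laver n x y \<in> laver_set n"
  using assms laver_rec_in[of x "2 ^ n" y] by (simp add: laver_eq_laver_rec) (simp add: laver_set_def)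

lemma laver_selfdistrib:
  assumes "x \<in> laver_set n" "y \<in> laver_set n" "z \<in> laver_set n"
  shows "laver n x (laver n y z) = laver n (laver n x y) (laver n x z)"
  using assms laver_in_laver_set[of _ n]
    laver_rec_selfdistrib[OF dyadic_periods_power, of x n y z, folded laver_set_def]
  by (simp add: laver_eq_laver_rec)

lemma laver_period_eq:
  assumes "p \<in> laver_set n" "p < 2 ^ n" "row_period (2 ^ n) p (2 ^ k)"
  shows "laver_period n p = 2 ^ k"
proof -
  have row: "laver n p q = laver_rec (2 ^ n) p q" if "q \<in> laver_set n" for q
    using laver_eq_laver_rec assms that by simp
  have sub: "q \<in> laver_set n" if "q \<in> {1..2 ^ k}" for q
    using that row_period_le[OF assms(2,3)] by (simp add: laver_set_def del: power_increasing_iff)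
  then have k: "2 ^ k \<in> laver_set n" by simp
  have less: "laver n p q < 2 ^ n" if "0 < q" "q < 2 ^ k" for q
    using assms(3) that row[of q] sub[of q] by (simp add: row_period_def)
  have end_k: "laver n p (2 ^ k) = 2 ^ n"
    using assms(3) row[OF k] by (simp add: row_period_def)
  show ?thesis
    unfolding laver_period_def
  proof (rule the_equality)
    have "strict_mono_on {1..2 ^ k} (laver n p)"
    proof (rule strict_mono_onI)
      fix r s :: nat assume rs: "r \<in> {1..2 ^ k}" "s \<in> {1..2 ^ k}" "r < s"
      have "laver_rec (2 ^ n) p r < laver_rec (2 ^ n) p s"
        using rs assms(3) by (intro laver_rec_less_row[OF assms(2)]) (auto simp: row_period_def)
      then show "laver n p r < laver n p s" using row sub rs by simp
    qed
    then show "is_laver_period n p (2 ^ k)"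
      using k end_k row row_period_add[OF assms(2,3)] by (auto simp: is_laver_period_def)
  \<comment> \<open>A smaller \<open>m\<close> would reach the top too early; a larger one would
    repeat the value \<open>2 ^ n\<close> on a strictly increasing stretch.\<close>
  next
    fix m assume m: "is_laver_period n p m"
    then have m0: "0 < m" "laver n p m = 2 ^ n" "strict_mono_on {1..m} (laver n p)"
      by (auto simp: is_laver_period_def)
    have "\<not> m < 2 ^ k" using less[of m] m0 by auto
    moreover have "\<not> 2 ^ k < m"
      using strict_mono_onD[OF m0(3), of "2 ^ k" m] m0 end_k by auto
    ultimately show "m = 2 ^ k" by simp
  qed
qed

section \<open>Thresholds\<close>

lemma ex_threshold:
  assumes "dyadic_periods M" "a < M" "row_period M a m"
  shows "\<exists>r\<le>m. (\<forall>q. 1 \<le> q \<and> q \<le> r \<longrightarrow> laver_rec (2 * M) a q = laver_rec M a q) \<and>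
    (\<forall>q. r < q \<and> q \<le> m \<longrightarrow> laver_rec (2 * M) a q = laver_rec M a q + M)"
proof -
  let ?v = "laver_rec (2 * M) a" and ?w = "laver_rec M a"
  have a: "a < 2 * M" using assms by simp
  have cases: "?v q = ?w q \<or> ?v q = ?w q + M" for q
    by (rule laver_rec_double_cases[OF assms(1,2)])
  have w: "0 < ?w q" "?w q \<le> M" for q using laver_rec_bounds[OF assms(2), of q] by auto
  have less: "?v q < 2 * M" if "0 < q" "q < m" for q
    using cases[of q] that assms(3) by (auto simp: row_period_def)
  \<comment> \<open>The threshold is the last position where the doubled row is still at most
    \<open>M\<close>; its growth keeps all earlier entries there too. Inserting \<open>0\<close>
    makes the maximum defined without checking that \<open>S\<close> is nonempty.\<close>
  define S where "S = {q. 1 \<le> q \<and> q \<le> m \<and> ?v q \<le> M}"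
  define r where "r = Max (insert 0 S)"
  have fin: "finite (insert 0 S)" by (simp add: S_def)
  have r: "r \<in> insert 0 S" unfolding r_def using fin by (intro Max_in) auto
  have r_max: "q \<le> r" if "q \<in> S" for q unfolding r_def using fin that by (intro Max_ge) auto
  have "?v q = ?w q" if q: "1 \<le> q" "q \<le> r" for q
  proof -
    have "r \<in> S" using r q by auto
    then have "r \<le> m" "?v r \<le> M" by (auto simp: S_def)
    moreover have "?v q < ?v r" if "q < r"
      using that q \<open>r \<le> m\<close> less by (intro laver_rec_less_row[OF a]) auto
    ultimately have "?v q \<le> M" using q by (cases "q = r") auto
    then show ?thesis using cases[of q] w[of q] by auto
  qed
  moreover have "?v q = ?w q + M" if "r < q" "q \<le> m" for q
  proof -
    have "q \<notin> S" using r_max[of q] that by auto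
    then show ?thesis using that cases[of q] w[of q] by (auto simp: S_def)
  qed
  moreover have "r \<le> m" using r by (auto simp: S_def)
  ultimately show ?thesis by blast
qed

text \<open>Just after the smaller of two thresholds, one demands a shift by
  \<open>2 ^ (n - 1)\<close> and the other none.\<close>

lemma is_laver_threshold_unique:
  assumes "is_laver_threshold n p r" "is_laver_threshold n p s"
  shows "r = s"
proof -
  have "\<not> t < u" if t: "is_laver_threshold n p t" and u: "is_laver_threshold n p u" for t u
  proof
    assume "t < u"
    then have "Suc t \<le> laver_period (n - 1) p" using u by (simp add: is_laver_threshold_def)
    then have "laver n p (Suc t) = laver (n - 1) p (Suc t) + 2 ^ (n - 1)"
      using t by (simp add: is_laver_threshold_def)
    moreover have "laver n p (Suc t) = laver (n - 1) p (Suc t)"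
      using u \<open>t < u\<close> by (simp add: is_laver_threshold_def)
    ultimately show False by simp
  qed
  then show ?thesis using assms by (meson linorder_neqE_nat)
qed

lemma laver_threshold:
  assumes "1 \<le> p" "p < 2 ^ n"
  shows "is_laver_threshold (Suc n) p (laver_threshold (Suc n) p)"
proof -
  obtain k where k: "row_period (2 ^ n) p (2 ^ k)"
    using dyadic_periods_power[of n] assms by (auto simp: dyadic_periods_def)
  have p: "p \<in> laver_set n" "p \<in> laver_set (Suc n)" using assms by (auto simp: laver_set_def)
  have period: "laver_period n p = 2 ^ k" by (rule laver_period_eq[OF p(1) assms(2) k])
  have k_le: "2 ^ k \<le> (2 ^ n :: nat)" using row_period_le[OF assms(2) k] by linarith
  have row: "laver n p q = laver_rec (2 ^ n) p q"
    "laver (Suc n) p q = laver_rec (2 * 2 ^ n) p q" if "1 \<le> q" "q \<le> 2 ^ k" for q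
  proof -
    have "q \<le> 2 ^ n" using that(2) k_le by (rule le_trans)
    then have "q \<in> laver_set n" "q \<in> laver_set (Suc n)" using that by (auto simp: laver_set_def)
    then show "laver n p q = laver_rec (2 ^ n) p q" "laver (Suc n) p q = laver_rec (2 * 2 ^ n) p q"
      using p by (simp_all add: laver_eq_laver_rec)
  qed
  obtain r where "r \<le> 2 ^ k"
    "\<And>q. 1 \<le> q \<Longrightarrow> q \<le> r \<Longrightarrow> laver_rec (2 * 2 ^ n) p q = laver_rec (2 ^ n) p q"
    "\<And>q. r < q \<Longrightarrow> q \<le> 2 ^ k \<Longrightarrow> laver_rec (2 * 2 ^ n) p q = laver_rec (2 ^ n) p q + 2 ^ n"
    using ex_threshold[OF dyadic_periods_power assms(2) k] by blast
  then have thr: "is_laver_threshold (Suc n) p r"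
    using row by (simp add: is_laver_threshold_def period)
  show ?thesis
    unfolding laver_threshold_def by (rule theI) (rule thr, rule is_laver_threshold_unique[OF _ thr])
qed

section \<open>The cocycle\<close>

lemma laver_theta_eq:
  assumes "x \<in> laver_set n" "y \<in> laver_set n"
  shows "laver_theta n x y = of_bool (y \<le> 2 ^ (n - 1)) - of_bool (laver n x y \<le> 2 ^ (n - 1))"
proof -
  have sum: "(\<Sum>r = 1..2 ^ (n - 1). of_bool (u = r) :: int) = of_bool (u \<le> 2 ^ (n - 1))"
    if "u \<in> laver_set n" for u :: nat
    using that by (simp add: of_bool_def laver_set_def)
  show ?thesis
    using sum[OF assms(2)] sum[OF laver_in_laver_set[OF assms]]
    by (simp add: laver_theta_def laver_phi_def sum_subtractf)
qed

text \<open>With \<open>g\<close> the indicator, both sides of the cocycle identity telescope to g z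
  - g (x \<triangleright> (y \<triangleright> z)): on the left g (x \<triangleright> z) cancels, on
  the right g (y \<triangleright> z).\<close>

lemma laver_theta_cocycle: "rack_2cocycle_on (laver_set n) (laver n) (laver_theta n)"
  by (auto simp: rack_2cocycle_on_def laver_theta_eq laver_in_laver_set
      laver_selfdistrib[symmetric])

theorem proposition5p3:
  fixes n :: nat
  assumes "n \<ge> 1"
  shows "rack_2cocycle_on (laver_set n) (laver n) (laver_theta n) \<and>
    (\<forall>p. 1 \<le> p \<and> p < 2 ^ (n - 1) \<longrightarrow>
       laver_threshold n p + 1 \<in> laver_set n \<and>
       laver_theta n p (laver_threshold n p + 1) = 1 \<and>
       (\<forall>y\<in>laver_set n. laver_theta n p y = 1 \<longrightarrow> laver_threshold n p + 1 \<le> y))"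
proof (rule conjI[OF laver_theta_cocycle], intro allI impI)
  fix p :: nat assume p: "1 \<le> p \<and> p < 2 ^ (n - 1)"
  obtain k where n: "n = Suc k" using assms by (cases n) auto
  define M :: nat where "M = 2 ^ k"
  define r where "r = laver_threshold n p"
  have pM: "1 \<le> p" "p < M" using p by (auto simp: n M_def)
  have sets: "laver_set k = {1..M}" "laver_set n = {1..2 * M}" by (auto simp: laver_set_def n M_def)
  obtain j where j: "row_period M p (2 ^ j)"
    using dyadic_periods_power[of k] pM by (auto simp: dyadic_periods_def M_def)
  define m :: nat where "m = 2 ^ j"
  have m: "laver_period k p = m"
    using laver_period_eq[of p k j] pM j by (simp add: sets M_def[symmetric] m_def)
  \<comment> \<open>Strictness keeps \<open>Suc r\<close> within \<open>{1..M}\<close> even when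
    \<open>r = m\<close>.\<close>
  have mM: "m < M" using row_period_le[OF pM(2) j] pM(1) by (simp add: m_def)
  have rec_k: "laver k p q = laver_rec M p q" if "1 \<le> q" "q \<le> M" for q
    using laver_eq_laver_rec[of p k q] that pM by (simp add: sets M_def)
  have rec_n: "laver n p q = laver_rec (2 * M) p q" if "1 \<le> q" "q \<le> 2 * M" for q
    using laver_eq_laver_rec[of p n q] that pM by (simp add: sets) (simp add: n M_def)
  have theta: "laver_theta n p y = 1 \<longleftrightarrow> y \<le> M \<and> M < laver n p y" if "y \<in> laver_set n" for y
  proof -
    have "p \<in> laver_set n" using pM by (simp add: sets)
    from laver_theta_eq[OF this that] show ?thesis by (simp add: n M_def of_bool_def not_le)
  qed
  have thr: "is_laver_threshold n p r"
    using laver_threshold[of p k] pM by (simp add: r_def n M_def)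
  then have r: "r \<le> m"
    "\<And>q. 1 \<le> q \<Longrightarrow> q \<le> r \<Longrightarrow> laver n p q = laver k p q"
    "\<And>q. r < q \<Longrightarrow> q \<le> m \<Longrightarrow> laver n p q = laver k p q + M"
    by (auto simp: is_laver_threshold_def n m M_def)
  have "Suc r \<le> M" using r(1) mM by simp
  moreover have "M < laver n p (Suc r)"
  proof (cases "r < m")
    case True
    then show ?thesis
      using r(3)[of "Suc r"] rec_k[of "Suc r"] laver_rec_gt[OF pM(2), of "Suc r"] mM by simp
  next
    case False
    then have "r = m" using r(1) by simp
    moreover have "0 < m" by (simp add: m_def)
    \<comment> \<open>The rows still agree at \<open>m\<close>, where the smaller one ends with
      \<open>M\<close>; the doubled row has not reached \<open>2 * M\<close> and must grow
      further.\<close>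
    ultimately have "laver_rec (2 * M) p m = M"
      using r(2)[of m] rec_k[of m] rec_n[of m] j mM by (simp add: row_period_def m_def)
    then have "M < laver_rec (2 * M) p (Suc m)"
      using laver_rec_less_Suc[of p "2 * M" m] pM by simp
    then show ?thesis using rec_n[of "Suc m"] mM \<open>r = m\<close> by simp
  qed
  \<comment> \<open>Up to the threshold the values come from the smaller table, so they are at most
    \<open>M\<close> and the second indicator does not vanish.\<close>
  moreover have "Suc r \<le> y" if y: "y \<in> laver_set n" "laver_theta n p y = 1" for y
  proof (rule ccontr)
    assume "\<not> Suc r \<le> y"
    then have "laver n p y = laver_rec M p y"
      using y(1) r(1,2) rec_k[of y] mM by (simp add: sets)
    then show False using theta[OF y(1)] y(2) laver_rec_le[OF pM(2), of y] by simp
  qed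
  ultimately show "laver_threshold n p + 1 \<in> laver_set n \<and>
       laver_theta n p (laver_threshold n p + 1) = 1 \<and>
       (\<forall>y\<in>laver_set n. laver_theta n p y = 1 \<longrightarrow> laver_threshold n p + 1 \<le> y)"
    using theta[of "Suc r"] by (auto simp: r_def[symmetric] sets)
qed

end
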